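(* Let $\boldsymbol m=(m_j)_{j\in[K]}$ be a GFQ requirement ($m_j\ge0$, $M:=\sum_{j\in[K]}m_j\le B$), put $\theta_0:=1$, $C_j:=B-\sum_{i=1}^{j-1}m_i$, $D_j:=\sum_{i=1}^{j-1}m_i\theta_i$, $$\alpha_0^*:=1+\ln\theta_K-\sum_{j=1}^{K-1}\frac{m_j}{B}\ln\left(\frac{\theta_K}{\theta_j}\right),$$ and, for $j^*\in[K]$ (and $M<B$), $$\alpha_{j^*}:=\frac{D_{j^*}}{M}+\frac{C_{j^*}}{B-M}\,W\!\left(\frac{\theta_K(B-M)}{M}\exp\left(-\frac{\sum_{i=j^*}^{K-1}m_i\ln(\theta_K/\theta_i)}{C_{j^*}}\right)\exp\left(-\frac{D_{j^*}(B-M)}{C_{j^*}M}\right)\right),$$ where $W$ is the Lambert $W$ function. Then no online algorithm that satisfies the GFQ requirement $\boldsymbol m$ on every admissible instance can have a competitive ratio smaller than - $\alpha_0^*$, if $M\le B/\alpha_0^*$; - $\alpha_{j^*}$, if $M\in\left(\frac{\theta_{j^*-1}C_{j^*}+D_{j^*}}{\alpha_{j^*}},\frac{\theta_{j^*}C_{j^*}+D_{j^*}}{\alpha_{j^*}}\right]$ for some $j^*\in[K]$.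
   Context: Setting. Fix a resource budget $B>0$, a number of classes $K\ge1$ and numbers $1\le\theta_1\le\dots\le\theta_K$; $[K]=\{1,\dots,K\}$. An instance is a finite sequence $I=\{(v_t,j_t,r_t)\}_{t=1}^T$ of agents, where $j_t\in[K]$ is the class, $v_t\in[1,\theta_{j_t}]$ the valuation and $r_t\ge0$ the rate limit of agent $t$. An online algorithm knows $B,K,(\theta_j),\boldsymbol m$, but not $T$; when agent $t$ arrives it irrevocably chooses $x_t\in[0,r_t]$ depending only on the first $t$ agents, and $\sum_t x_t\le B$ must hold. Its value is $\mathrm{ALG}(I)=\sum_t v_tx_t$. GFQ (group fairness by quantity). An allocation satisfies GFQ with requirement $\boldsymbol m$ if $\sum_{t:\,j_t=j}x_t\ge m_j$ for all $j\in[K]$. An instance is admissible if $\sum_{t: j_t=j}r_t\ge m_j$ for all $j\in[K]$. The offline optimum on an admissible instance is $$\mathrm{OPT}(I)=\max\Big\{\sum_t v_tx_t:\ x_t\in[0,r_t],\ \sum_t x_t\le B,\ \sum_{t:j_t=j}x_t\ge m_j\ \forall j\in[K]\Big\}.$$ The competitive ratio of an online algorithm is $\sup_I \mathrm{OPT}(I)/\mathrm{ALG}(I)$ over all admissible instances $I$. *)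

theory Defs
  imports Complex_Main "HOL-Library.Extended_Real"
begin

datatype agent = Agent (valuation: real) (cls: nat) (rate: real)

definition is_instance :: "nat \<Rightarrow> (nat \<Rightarrow> real) \<Rightarrow> agent list \<Rightarrow> bool" where
  "is_instance K \<theta> I \<longleftrightarrow>
     (\<forall>a\<in>set I. cls a \<in> {1..K} \<and> valuation a \<in> {1..\<theta> (cls a)} \<and> 0 \<le> rate a)"

(* Agents are numbered from 0: agent t of the list I is I ! t. An allocation is a function on
   indices, of which only the values below length I matter. *)

definition class_total :: "agent list \<Rightarrow> (nat \<Rightarrow> real) \<Rightarrow> nat \<Rightarrow> real" where
  "class_total I x j = (\<Sum>t | t < length I \<and> cls (I ! t) = j. x t)"

definition feasible :: "real \<Rightarrow> agent list \<Rightarrow> (nat \<Rightarrow> real) \<Rightarrow> bool" where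
  "feasible B I x \<longleftrightarrow>
     (\<forall>t<length I. x t \<in> {0..rate (I ! t)}) \<and> (\<Sum>t<length I. x t) \<le> B"

definition satisfies_GFQ :: "nat \<Rightarrow> (nat \<Rightarrow> real) \<Rightarrow> agent list \<Rightarrow> (nat \<Rightarrow> real) \<Rightarrow> bool" where
  "satisfies_GFQ K m I x \<longleftrightarrow> (\<forall>j\<in>{1..K}. m j \<le> class_total I x j)"

definition admissible :: "nat \<Rightarrow> (nat \<Rightarrow> real) \<Rightarrow> (nat \<Rightarrow> real) \<Rightarrow> agent list \<Rightarrow> bool" where
  "admissible K \<theta> m I \<longleftrightarrow> is_instance K \<theta> I \<and>
     (\<forall>j\<in>{1..K}. m j \<le> class_total I (\<lambda>t. rate (I ! t)) j)"

definition alloc_value :: "agent list \<Rightarrow> (nat \<Rightarrow> real) \<Rightarrow> real" where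
  "alloc_value I x = (\<Sum>t<length I. valuation (I ! t) * x t)"

(* On an admissible instance with sum of the m j at most B, the set below is nonempty and
   compact, so the supremum is a maximum. *)
definition OPT :: "real \<Rightarrow> nat \<Rightarrow> (nat \<Rightarrow> real) \<Rightarrow> agent list \<Rightarrow> real" where
  "OPT B K m I = Sup {alloc_value I x | x. feasible B I x \<and> satisfies_GFQ K m I x}"

(* An online algorithm maps the list of agents seen so far, the current one last, to the
   quantity given to the current agent. *)
definition run :: "(agent list \<Rightarrow> real) \<Rightarrow> agent list \<Rightarrow> nat \<Rightarrow> real" where
  "run A I t = A (take (Suc t) I)"

definition online_algorithm ::
  "real \<Rightarrow> nat \<Rightarrow> (nat \<Rightarrow> real) \<Rightarrow> (agent list \<Rightarrow> real) \<Rightarrow> bool" where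
  "online_algorithm B K \<theta> A \<longleftrightarrow> (\<forall>I. is_instance K \<theta> I \<longrightarrow> feasible B I (run A I))"

definition ALG :: "(agent list \<Rightarrow> real) \<Rightarrow> agent list \<Rightarrow> real" where
  "ALG A I = alloc_value I (run A I)"

(* Division in ereal: a positive OPT over ALG = 0 gives infinity, and 0 / 0 = 0, so an instance
   on which nothing can be gained does not affect the supremum. *)
definition competitive_ratio ::
  "real \<Rightarrow> nat \<Rightarrow> (nat \<Rightarrow> real) \<Rightarrow> (nat \<Rightarrow> real) \<Rightarrow> (agent list \<Rightarrow> real) \<Rightarrow> ereal" where
  "competitive_ratio B K \<theta> m A =
     (SUP I\<in>{I. admissible K \<theta> m I}. ereal (OPT B K m I) / ereal (ALG A I))"

(* Principal branch; only nonnegative arguments are used below. *)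
definition lambert_W :: "real \<Rightarrow> real" where
  "lambert_W x = (THE w. -1 \<le> w \<and> w * exp w = x)"

definition total_req :: "nat \<Rightarrow> (nat \<Rightarrow> real) \<Rightarrow> real" where
  "total_req K m = (\<Sum>j=1..K. m j)"

definition coefC :: "real \<Rightarrow> (nat \<Rightarrow> real) \<Rightarrow> nat \<Rightarrow> real" where
  "coefC B m j = B - (\<Sum>i=1..<j. m i)"

definition coefD :: "(nat \<Rightarrow> real) \<Rightarrow> (nat \<Rightarrow> real) \<Rightarrow> nat \<Rightarrow> real" where
  "coefD \<theta> m j = (\<Sum>i=1..<j. m i * \<theta> i)"

definition alpha_zero :: "real \<Rightarrow> nat \<Rightarrow> (nat \<Rightarrow> real) \<Rightarrow> (nat \<Rightarrow> real) \<Rightarrow> real" where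
  "alpha_zero B K \<theta> m = 1 + ln (\<theta> K) - (\<Sum>j=1..<K. m j / B * ln (\<theta> K / \<theta> j))"

(* Meaningful for 0 < total_req K m < B. *)
definition alpha :: "real \<Rightarrow> nat \<Rightarrow> (nat \<Rightarrow> real) \<Rightarrow> (nat \<Rightarrow> real) \<Rightarrow> nat \<Rightarrow> real" where
  "alpha B K \<theta> m j =
     (let M = total_req K m; C = coefC B m j; D = coefD \<theta> m j in
      D / M + C / (B - M) *
        lambert_W (\<theta> K * (B - M) / M
          * exp (- ((\<Sum>i=j..<K. m i * ln (\<theta> K / \<theta> i)) / C))
          * exp (- (D * (B - M) / (C * M)))))"

end

theory Submission imports Defs begin

text \<open>
  The adversary sends levels of agents: the level of value \<open>v\<close> has one agent of rate \<open>B\<close> and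
  valuation \<open>min v (\<theta> j)\<close> in every class \<open>j\<close>, so any nonempty sequence of levels is admissible
  and the adversary may stop after each of them. The values are \<open>1\<close>, then
  \<open>u, u q, u q\<^sup>2, \<dots>, \<theta> K\<close>.

  Let \<open>G v = (B - M) v + (\<Sum>j. m j * min v (\<theta> j))\<close>, a lower bound for the optimum once level \<open>v\<close>
  has arrived. After each level an algorithm of ratio \<open>\<rho>\<close> has gained \<open>a \<ge> M\<close> and
  \<open>a \<ge> G v / \<rho>\<close>, and level \<open>v\<close> raises \<open>a\<close> by at most \<open>v\<close> times the quantity spent on it. With
  \<open>y\<close> the total quantity spent, the potential \<open>y - (a - G v / \<rho>) / v\<close> therefore grows at every
  step by at least the increase of \<open>G\<close> divided by \<open>\<rho> v\<close>. As \<open>y \<le> B\<close>, letting \<open>q\<close> tend to 1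
  gives, for every \<open>u\<close> in \<open>[1, \<theta> K]\<close>, a lower bound for \<open>\<rho>\<close>. It is \<open>alpha_zero\<close> at \<open>u = 1\<close>,
  and \<open>alpha\<close> at the point \<open>u\<close> where \<open>G u = alpha * M\<close>.
\<close>

section \<open>Runs on concatenated instances and bounds on values\<close>

lemma sum_lessThan_append:
  fixes f :: "nat \<Rightarrow> 'a::comm_monoid_add"
  shows "sum f {..<a + b} = sum f {..<a} + (\<Sum>s<b. f (a + s))"
  by (induction b) (auto simp: add.assoc)

lemma run_append:
  assumes "t < length I"
  shows "run A (I @ J) t = run A I t"
  using assms by (simp add: run_def)

text \<open>Decisions on \<open>I\<close> are made before \<open>J\<close> is seen, so both runs
  agree on \<open>I\<close>, and \<open>J\<close> adds at most \<open>c\<close> per unit spent on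
  it.\<close>

lemma alloc_value_append_run_le:
  assumes "feasible B (I @ J) (run A (I @ J))" and "\<forall>a\<in>set J. valuation a \<le> c"
  shows "alloc_value (I @ J) (run A (I @ J))
    \<le> alloc_value I (run A I) + c * (sum (run A (I @ J)) {..<length (I @ J)} - sum (run A I) {..<length I})"
proof -
  define x where "x = run A (I @ J)"
  have x0: "0 \<le> x (length I + s)" if "s < length J" for s
    using assms(1) that by (auto simp: feasible_def x_def)
  have "sum x {..<length (I @ J)} - sum (run A I) {..<length I} = (\<Sum>s<length J. x (length I + s))"
    by (simp add: sum_lessThan_append x_def run_append cong: sum.cong_simp)
  moreover have "alloc_value (I @ J) x
      = alloc_value I (run A I) + (\<Sum>s<length J. valuation (J ! s) * x (length I + s))"
    by (simp add: alloc_value_def sum_lessThan_append x_def run_append nth_append cong: sum.cong_simp)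
  moreover have "(\<Sum>s<length J. valuation (J ! s) * x (length I + s))
      \<le> (\<Sum>s<length J. c * x (length I + s))"
    using assms(2) x0 by (intro sum_mono mult_right_mono) auto
  ultimately show ?thesis by (simp add: sum_distrib_left x_def)
qed

lemma sum_class_total:
  assumes "is_instance K \<theta> I"
  shows "(\<Sum>j=1..K. class_total I x j) = sum x {..<length I}"
proof -
  have "(\<Sum>j=1..K. \<Sum>t\<in>{t \<in> {..<length I}. cls (I ! t) = j}. x t) = sum x {..<length I}"
    using assms by (intro sum.group) (auto simp: is_instance_def)
  then show ?thesis by (simp add: class_total_def)
qed

text \<open>Valuations are at least 1, so the value is at least the quantity allocated.\<close>

lemma total_req_le_alloc_value:
  assumes "is_instance K \<theta> I" "feasible B I x" "satisfies_GFQ K m I x"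
  shows "total_req K m \<le> alloc_value I x"
proof -
  have "total_req K m \<le> (\<Sum>j=1..K. class_total I x j)"
    using assms(3) by (auto simp: total_req_def satisfies_GFQ_def intro!: sum_mono)
  also have "\<dots> = sum x {..<length I}" by (rule sum_class_total[OF assms(1)])
  also have "\<dots> \<le> alloc_value I x"
    unfolding alloc_value_def
  proof (rule sum_mono)
    fix t assume "t \<in> {..<length I}"
    then have "1 \<le> valuation (I ! t)" "0 \<le> x t"
      using assms(1,2) by (auto simp: is_instance_def feasible_def)
    then show "x t \<le> valuation (I ! t) * x t"
      using mult_right_mono[of 1 "valuation (I ! t)" "x t"] by simp
  qed
  finally show ?thesis .
qed

text \<open>A real supremum needs a bounded set: serving all agents at full rate dominates every
  feasible value.\<close>

lemma alloc_value_le_OPT: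
  assumes "is_instance K \<theta> I" "feasible B I x" "satisfies_GFQ K m I x"
  shows "alloc_value I x \<le> OPT B K m I"
  unfolding OPT_def
proof (rule cSup_upper)
  show "bdd_above {alloc_value I x |x. feasible B I x \<and> satisfies_GFQ K m I x}"
  proof (rule bdd_aboveI)
    fix z assume "z \<in> {alloc_value I x |x. feasible B I x \<and> satisfies_GFQ K m I x}"
    then obtain y where y: "z = alloc_value I y" "feasible B I y" by auto
    show "z \<le> (\<Sum>t<length I. valuation (I ! t) * rate (I ! t))"
      unfolding y(1) alloc_value_def
    proof (rule sum_mono)
      fix t assume "t \<in> {..<length I}"
      then have "1 \<le> valuation (I ! t)" "y t \<le> rate (I ! t)"
        using assms(1) y(2) by (auto simp: is_instance_def feasible_def)
      then show "valuation (I ! t) * y t \<le> valuation (I ! t) * rate (I ! t)"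
        by (intro mult_left_mono) auto
    qed
  qed
qed (use assms in auto)

section \<open>The levels sent by the adversary\<close>

definition level :: "real \<Rightarrow> nat \<Rightarrow> (nat \<Rightarrow> real) \<Rightarrow> real \<Rightarrow> agent list" where
  "level B K \<theta> v = map (\<lambda>j. Agent (min v (\<theta> j)) j B) [1..<Suc K]"

fun levels :: "real \<Rightarrow> nat \<Rightarrow> (nat \<Rightarrow> real) \<Rightarrow> (nat \<Rightarrow> real) \<Rightarrow> nat \<Rightarrow> agent list" where
  "levels B K \<theta> v 0 = []"
| "levels B K \<theta> v (Suc n) = levels B K \<theta> v n @ level B K \<theta> (v n)"

lemma length_level [simp]: "length (level B K \<theta> v) = K"
  by (simp add: level_def)

lemma nth_level [simp]:
  "s < K \<Longrightarrow> level B K \<theta> v ! s = Agent (min v (\<theta> (Suc s))) (Suc s) B"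
  by (simp add: level_def del: upt_Suc)

lemma is_instance_level:
  assumes "0 \<le> B" "1 \<le> v" "\<forall>j\<in>{1..K}. 1 \<le> \<theta> j"
  shows "is_instance K \<theta> (level B K \<theta> v)"
  using assms by (auto simp: is_instance_def level_def)

lemma is_instance_levels:
  assumes "0 \<le> B" "\<And>k. k < n \<Longrightarrow> 1 \<le> v k" "\<forall>j\<in>{1..K}. 1 \<le> \<theta> j"
  shows "is_instance K \<theta> (levels B K \<theta> v n)"
  using assms(2)
proof (induction n)
  case (Suc n)
  then show ?case
    using is_instance_level[OF assms(1) _ assms(3), of "v n"] by (auto simp: is_instance_def)
qed (simp add: is_instance_def)

lemma class_total_append_level:
  assumes "s < K"
  shows "class_total (I @ level B K \<theta> v) x (Suc s)
    = class_total I x (Suc s) + x (length I + s)"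
proof -
  have "class_total J x j = (\<Sum>t<length J. if cls (J ! t) = j then x t else 0)" for J j
    unfolding class_total_def
    by (subst sum.inter_filter[symmetric]) (auto intro: sum.cong)
  then show ?thesis
    using assms by (simp add: sum_lessThan_append nth_append cong: sum.cong_simp)
qed

text \<open>The witness spends nothing on \<open>I\<close> and gives \<open>w j\<close> to the class
  \<open>j\<close> agent of the last level, whose rate \<open>B\<close> can hold it.\<close>

lemma OPT_append_level_ge:
  assumes inst: "is_instance K \<theta> (I @ level B K \<theta> v)"
    and w: "\<forall>j\<in>{1..K}. 0 \<le> w j \<and> m j \<le> w j" "(\<Sum>j=1..K. w j) \<le> B"
  shows "(\<Sum>j=1..K. w j * min v (\<theta> j)) \<le> OPT B K m (I @ level B K \<theta> v)"
proof -
  let ?J = "I @ level B K \<theta> v"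
  define x where "x = (\<lambda>t. if t < length I then 0 else w (Suc (t - length I)))"
  have shift: "(\<Sum>s<K. f (Suc s)) = (\<Sum>j=1..K. f j)" for f :: "nat \<Rightarrow> real"
    using sum.shift_bounds_cl_Suc_ivl[of f 0 "K - 1"]
    by (cases K) (auto simp: lessThan_Suc_atMost atLeast0AtMost)
  have wB: "w j \<le> B" if "j \<in> {1..K}" for j
    using member_le_sum[of j "{1..K}" w] that w by auto
  then have B0: "0 \<le> B" using w by (meson order_trans sum_nonneg)
  have ge0: "0 \<le> rate (?J ! t)" if "t < length ?J" for t
    using inst that unfolding is_instance_def by (meson nth_mem)
  have "alloc_value ?J x = (\<Sum>j=1..K. w j * min v (\<theta> j))"
    using shift[of "\<lambda>j. w j * min v (\<theta> j)"]
    by (simp add: alloc_value_def x_def sum_lessThan_append nth_append mult.commute cong: sum.cong_simp)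
  moreover have "feasible B ?J x"
    unfolding feasible_def
  proof (intro conjI allI impI)
    fix t assume t: "t < length ?J"
    show "x t \<in> {0..rate (?J ! t)}"
      using ge0[OF t] wB w(1) t by (auto simp: x_def nth_append not_less)
  next
    show "sum x {..<length ?J} \<le> B"
      using w(2) by (simp add: x_def sum_lessThan_append shift)
  qed
  moreover have "satisfies_GFQ K m ?J x"
    unfolding satisfies_GFQ_def
  proof
    fix j assume j: "j \<in> {1..K}"
    then obtain s where s: "j = Suc s" "s < K" by (cases j) auto
    have "class_total I x j = 0" by (simp add: class_total_def x_def)
    then show "m j \<le> class_total ?J x j"
      using j s w(1) by (simp add: class_total_append_level x_def)
  qed
  ultimately show ?thesis
    using alloc_value_le_OPT[OF inst] by metis
qed

section \<open>Logarithms, the Lambert function and the ratio\<close>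

text \<open>Below the cap this is \<open>ln x \<le> x - 1\<close> at the quotient of the two values;
  from the cap on both sides vanish. Dividing by \<open>q\<close> turns the denominator
  \<open>v\<close> into \<open>q * v\<close>, the value of the next level.\<close>

lemma ln_min_diff_le:
  fixes v q c :: real
  assumes "0 < v" "1 \<le> q" "0 < c"
  shows "(ln (min (q * v) c) - ln (min v c)) / q \<le> (min (q * v) c - min v c) / (q * v)"
proof (cases "v < c")
  case True
  let ?b = "min (q * v) c"
  have b: "0 < ?b" using assms by simp
  have "ln ?b - ln v \<le> (?b - v) / v"
    using ln_le_minus_one[of "?b / v"] b assms by (simp add: ln_div diff_divide_distrib)
  then have "(ln ?b - ln v) / q \<le> (?b - v) / v / q"
    using assms by (intro divide_right_mono) auto
  with True show ?thesis by (simp add: mult.commute)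
next
  case False
  have "v \<le> q * v" using assms by simp
  with False show ?thesis by simp
qed

text \<open>Existence is the intermediate value theorem on [0, x]. Every solution is positive
  because \<open>x\<close> is, and \<open>w * exp w\<close> is strictly increasing there.\<close>

lemma lambert_W_eq:
  assumes "0 < x"
  shows "0 < lambert_W x" "lambert_W x * exp (lambert_W x) = x"
proof -
  have "\<exists>w\<ge>0. w \<le> x \<and> w * exp w = x"
  proof (rule IVT')
    show "x \<le> x * exp x" using assms by simp
  qed (use assms in \<open>auto intro!: continuous_intros\<close>)
  then obtain w where w: "0 \<le> w" "w * exp w = x" by auto
  have pos: "0 < z" if "z * exp z = x" for z
    using assms that by (metis exp_gt_zero zero_less_mult_pos2)
  have "lambert_W x = w"
    unfolding lambert_W_def
  proof (rule the_equality)
    fix z assume "-1 \<le> z \<and> z * exp z = x"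
    then have z: "z * exp z = x" by simp
    show "z = w"
    proof (rule ccontr)
      assume "z \<noteq> w"
      then consider "z < w" | "w < z" by linarith
      then have "z * exp z \<noteq> w * exp w"
      proof cases
        case 1
        then show ?thesis using pos[OF z] by (intro less_imp_neq mult_strict_mono) auto
      next
        case 2
        then show ?thesis using w by (intro less_imp_neq[symmetric] mult_strict_mono) auto
      qed
      then show False using z w by simp
    qed
  qed (use w in auto)
  then show "0 < lambert_W x" "lambert_W x * exp (lambert_W x) = x" using w pos by auto
qed

text \<open>With \<open>w\<close> the Lambert value, \<open>u = w * M / (B - M)\<close>; taking
  logarithms in \<open>w * exp w = z\<close> yields the logarithmic expression met in
  \<open>ratio_ge_alpha\<close>.\<close>

lemma alpha_fixed_point:
  fixes \<theta> m :: "nat \<Rightarrow> real" and j :: nat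
  assumes "0 < total_req K m" "total_req K m < B" "0 < coefC B m j" "0 < \<theta> K"
  defines "u \<equiv> (alpha B K \<theta> m j * total_req K m - coefD \<theta> m j) / coefC B m j"
  shows "alpha B K \<theta> m j * (B - total_req K m)
      = coefC B m j * ln (\<theta> K / u) - (\<Sum>i=j..<K. m i * ln (\<theta> K / \<theta> i))"
proof -
  define M C D S where "M = total_req K m" "C = coefC B m j" "D = coefD \<theta> m j"
    "S = (\<Sum>i=j..<K. m i * ln (\<theta> K / \<theta> i))"
  note defs = this
  define z where "z = \<theta> K * (B - M) / M * exp (- (S / C)) * exp (- (D * (B - M) / (C * M)))"
  define w where "w = lambert_W z"
  have MC: "0 < M" "M < B" "0 < C" using assms(1-3) by (simp_all add: defs)
  then have z: "0 < z" using assms(4) by (simp add: z_def)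
  note w = lambert_W_eq[OF z, folded w_def]
  have al: "alpha B K \<theta> m j = D / M + C / (B - M) * w"
    by (simp add: alpha_def Let_def defs w_def z_def)
  have u: "u = w * M / (B - M)"
    unfolding u_def al using MC by (simp add: defs[symmetric] field_simps)
  have "ln w + w = ln z"
    using w by (metis ln_exp ln_mult_pos exp_gt_zero)
  also have "\<dots> = ln (\<theta> K * (B - M) / M) - S / C - D * (B - M) / (C * M)"
    unfolding z_def using MC assms(4)
    by (simp add: ln_mult_pos del: times_divide_eq_left times_divide_eq_right)
  finally have "w = ln (\<theta> K * (B - M) / M) - ln w - S / C - D * (B - M) / (C * M)" by simp
  also have "ln (\<theta> K * (B - M) / M) - ln w = ln (\<theta> K / u)"
    unfolding u using MC w assms(4) by (simp add: ln_div ln_mult_pos)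
  finally have "C * w = C * (ln (\<theta> K / u) - S / C - D * (B - M) / (C * M))" by simp
  then have "C * w = C * ln (\<theta> K / u) - S - D * (B - M) / M"
    using MC by (simp add: right_diff_distrib[of C])
  moreover have "alpha B K \<theta> m j * (B - M) = D * (B - M) / M + C * w"
    unfolding al using MC by (simp add: field_simps)
  ultimately show "alpha B K \<theta> m j * (B - total_req K m)
      = coefC B m j * ln (\<theta> K / u) - (\<Sum>i=j..<K. m i * ln (\<theta> K / \<theta> i))"
    by (simp add: defs)
qed

text \<open>A positive optimum over a gain of 0 is infinite in \<open>ereal\<close>, so a real bound
  forces a positive gain.\<close>

lemma OPT_le_mult_ALG:
  assumes "competitive_ratio B K \<theta> m A \<le> ereal \<rho>" "admissible K \<theta> m I"
    and "0 \<le> ALG A I" "0 < OPT B K m I"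
  shows "0 < \<rho>" "OPT B K m I \<le> \<rho> * ALG A I"
proof -
  have *: "ereal (OPT B K m I) / ereal (ALG A I) \<le> ereal \<rho>"
    using assms(1,2) unfolding competitive_ratio_def SUP_le_iff by auto
  have "ALG A I \<noteq> 0"
    using * assms(4) by (auto simp: divide_ereal_def)
  with assms(3) have "0 < ALG A I" by simp
  with * have "OPT B K m I / ALG A I \<le> \<rho>" by simp
  with \<open>0 < ALG A I\<close> show "OPT B K m I \<le> \<rho> * ALG A I" by (simp add: field_simps)
  with assms(4) \<open>0 < ALG A I\<close> show "0 < \<rho>" by (smt (verit) mult_nonpos_nonneg)
qed

section \<open>The algorithm against the levels\<close>

locale gfq_algorithm =
  fixes B :: real and K :: nat and \<theta> m :: "nat \<Rightarrow> real" and A :: "agent list \<Rightarrow> real"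
  assumes B_pos: "0 < B" and K_pos: "1 \<le> K" and theta_ge_1: "\<forall>j\<in>{1..K}. 1 \<le> \<theta> j"
    and theta_mono: "mono_on {1..K} \<theta>"
    and m_nonneg: "\<forall>j\<in>{1..K}. 0 \<le> m j" and M_le: "total_req K m \<le> B"
    and online: "online_algorithm B K \<theta> A"
    and gfq: "\<forall>I. admissible K \<theta> m I \<longrightarrow> satisfies_GFQ K m I (run A I)"
begin

abbreviation "M \<equiv> total_req K m"

text \<open>The offline allocation after a level: the part of the budget not reserved by the
  requirement goes to class \<open>K\<close>, whose agent is the most valuable one.\<close>

definition weight :: "nat \<Rightarrow> real" where
  "weight = m(K := m K + (B - M))"

text \<open>By \<open>sum_weight\<close>, this is the \<open>G\<close> described at the start as
  long as \<open>v \<le> \<theta> K\<close>.\<close>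

definition opt_at :: "real \<Rightarrow> real" where
  "opt_at v = (\<Sum>j=1..K. weight j * min v (\<theta> j))"

lemma sum_weight: "(\<Sum>j=1..K. weight j * f j) = (B - M) * f K + (\<Sum>j=1..K. m j * f j)"
proof -
  have "(\<Sum>j=1..K. weight j * f j)
      = (\<Sum>j=1..K. m j * f j + (if j = K then (B - M) * f K else 0))"
    by (intro sum.cong) (auto simp: weight_def algebra_simps)
  then show ?thesis using K_pos by (simp add: sum.distrib)
qed

lemma weight_ge: "\<forall>j\<in>{1..K}. 0 \<le> weight j \<and> m j \<le> weight j"
  using m_nonneg M_le by (auto simp: weight_def)

lemma sum_weight_eq: "(\<Sum>j=1..K. weight j) = B"
  using sum_weight[of "\<lambda>_. 1"] by (simp add: total_req_def)

lemma m_le_B: "j \<in> {1..K} \<Longrightarrow> m j \<le> B"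
  using member_le_sum[of j "{1..K}" m] m_nonneg M_le by (auto simp: total_req_def)

text \<open>The last level alone can meet every requirement, because
  \<open>m j \<le> B\<close>.\<close>

lemma admissible_levels:
  assumes "0 < n" "\<And>k. k < n \<Longrightarrow> 1 \<le> v k"
  shows "admissible K \<theta> m (levels B K \<theta> v n)"
proof -
  obtain n' where n: "n = Suc n'" using assms(1) by (cases n) auto
  have inst: "is_instance K \<theta> (levels B K \<theta> v k)" if "k \<le> n" for k
    using that assms B_pos theta_ge_1 by (intro is_instance_levels) auto
  have "m j \<le> class_total (levels B K \<theta> v n) (\<lambda>t. rate (levels B K \<theta> v n ! t)) j"
    if j: "j \<in> {1..K}" for j
  proof -
    let ?I = "levels B K \<theta> v n'"
    let ?r = "\<lambda>t. rate (levels B K \<theta> v n ! t)"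
    obtain s where s: "j = Suc s" "s < K" using j by (cases j) auto
    have "0 \<le> class_total ?I ?r j"
      unfolding class_total_def
      using inst[of n'] n by (intro sum_nonneg) (auto simp: is_instance_def nth_append)
    then show ?thesis
      using m_le_B[OF j] s by (simp add: n class_total_append_level nth_append)
  qed
  with inst[of n] show ?thesis by (auto simp: admissible_def)
qed

lemma opt_at_pos:
  assumes "1 \<le> v"
  shows "0 < opt_at v"
proof -
  have "(\<Sum>j=1..K. weight j) \<le> opt_at v"
    unfolding opt_at_def
  proof (rule sum_mono)
    fix j assume "j \<in> {1..K}"
    then have "0 \<le> weight j" "1 \<le> min v (\<theta> j)" using weight_ge theta_ge_1 assms by auto
    then show "weight j \<le> weight j * min v (\<theta> j)" using mult_left_mono[of 1 "min v (\<theta> j)" "weight j"] by simp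
  qed
  with B_pos show ?thesis using sum_weight_eq by linarith
qed

text \<open>The adversary may stop after any level, so the ratio and the requirement apply to every
  nonempty prefix.\<close>

lemma opt_at_le_ALG:
  assumes "competitive_ratio B K \<theta> m A \<le> ereal \<rho>" "\<And>k. k \<le> n \<Longrightarrow> 1 \<le> v k"
  shows "0 < \<rho>" "opt_at (v n) \<le> \<rho> * ALG A (levels B K \<theta> v (Suc n))"
    and "M \<le> ALG A (levels B K \<theta> v (Suc n))"
proof -
  let ?I = "levels B K \<theta> v (Suc n)"
  have adm: "admissible K \<theta> m ?I" using assms(2) by (intro admissible_levels) auto
  then have inst: "is_instance K \<theta> ?I" by (simp add: admissible_def)
  show M: "M \<le> ALG A ?I"
    using adm inst online gfq unfolding ALG_def
    by (intro total_req_le_alloc_value) (auto simp: online_algorithm_def)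
  have "0 \<le> M" using m_nonneg by (auto simp: total_req_def intro: sum_nonneg)
  have "opt_at (v n) \<le> OPT B K m ?I"
    using OPT_append_level_ge[of K \<theta> "levels B K \<theta> v n" B "v n" weight m]
      inst weight_ge sum_weight_eq by (simp add: opt_at_def)
  with opt_at_pos[of "v n"] assms(2) OPT_le_mult_ALG[OF assms(1) adm] M \<open>0 \<le> M\<close>
  show "0 < \<rho>" "opt_at (v n) \<le> \<rho> * ALG A ?I" by fastforce+
qed

abbreviation used :: "(nat \<Rightarrow> real) \<Rightarrow> nat \<Rightarrow> real" where
  "used v n \<equiv> sum (run A (levels B K \<theta> v n)) {..<length (levels B K \<theta> v n)}"

lemma feasible_levels:
  assumes "\<And>k. k < n \<Longrightarrow> 1 \<le> v k"
  shows "feasible B (levels B K \<theta> v n) (run A (levels B K \<theta> v n))"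
  using is_instance_levels[of B n v K \<theta>] assms B_pos theta_ge_1 online
  by (auto simp: online_algorithm_def)

lemma ALG_step:
  assumes "\<And>k. k \<le> n \<Longrightarrow> 1 \<le> v k"
  shows "ALG A (levels B K \<theta> v (Suc n))
    \<le> ALG A (levels B K \<theta> v n) + v n * (used v (Suc n) - used v n)"
  using alloc_value_append_run_le[of B "levels B K \<theta> v n" "level B K \<theta> (v n)" A "v n"]
    feasible_levels[of "Suc n" v] assms
  by (auto simp: ALG_def level_def simp del: upt_Suc)

section \<open>The potential argument and its limit\<close>

lemma discrete_bound:
  assumes ratio: "competitive_ratio B K \<theta> m A \<le> ereal \<rho>"
    and u: "1 \<le> u" and q: "1 \<le> q"
  shows "M * (1 - 1 / u) + (opt_at u / u
      + (\<Sum>j=1..K. weight j * (ln (min (u * q ^ N) (\<theta> j)) - ln (min u (\<theta> j)))) / q) / \<rho> \<le> B"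
proof -
  \<comment> \<open>Levels are counted from 0, while \<open>a n\<close> and \<open>y n\<close> are
    taken after \<open>n\<close> levels; hence \<open>u * q ^ n\<close> goes with
    \<open>n + 2\<close>.\<close>
  define v where "v = (\<lambda>k. if k = 0 then 1 else u * q ^ (k - 1))"
  have "1 \<le> u * q ^ k" for k
    using mult_mono[of 1 u 1 "q ^ k"] u q by simp
  then have v1: "1 \<le> v k" for k by (simp add: v_def)
  have vS: "v (Suc k) = u * q ^ k" for k by (simp add: v_def)
  define a where "a = (\<lambda>n. ALG A (levels B K \<theta> v n))"
  define y where "y = used v"
  have \<rho>: "0 < \<rho>" using opt_at_le_ALG(1)[OF ratio v1] .
  have aM: "M \<le> a (Suc n)" and aopt: "opt_at (v n) / \<rho> \<le> a (Suc n)" for n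
    using opt_at_le_ALG(2,3)[OF ratio v1, where n = n] \<rho> by (simp_all add: a_def field_simps)
  have step: "a (Suc n) \<le> a n + v n * (y (Suc n) - y n)" for n
    using ALG_step[OF v1] by (simp add: a_def y_def)
  \<comment> \<open>An antiderivative of the slope of \<open>opt_at\<close> divided by the argument:
    each summand has slope \<open>weight j / x\<close> below \<open>\<theta> j\<close> and is
    constant above.\<close>
  define L where "L = (\<lambda>x. \<Sum>j=1..K. weight j * ln (min x (\<theta> j)))"
  have L: "(L (q * x) - L x) / q \<le> (opt_at (q * x) - opt_at x) / (q * x)" if "0 < x" for x
  proof -
    have "(\<Sum>j=1..K. weight j * ((ln (min (q * x) (\<theta> j)) - ln (min x (\<theta> j))) / q))
      \<le> (\<Sum>j=1..K. weight j * ((min (q * x) (\<theta> j) - min x (\<theta> j)) / (q * x)))"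
      using that q weight_ge theta_ge_1 by (intro sum_mono mult_left_mono ln_min_diff_le) force+
    then show ?thesis
      by (simp add: L_def opt_at_def right_diff_distrib sum_subtractf sum_divide_distrib
          diff_divide_distrib)
  qed
  \<comment> \<open>On the right is the potential after \<open>n + 2\<close> levels, on the left its
    bound after two levels plus the later growth, telescoped through \<open>L\<close>.\<close>
  have main: "M * (1 - 1 / u) + (opt_at u / u + (L (u * q ^ n) - L u) / q) / \<rho>
      \<le> y (n + 2) - (a (n + 2) - opt_at (u * q ^ n) / \<rho>) / (u * q ^ n)" for n
  proof (induction n)
    case 0
    have "a 0 = 0" "y 0 = 0" by (simp_all add: a_def y_def ALG_def alloc_value_def)
    then have "a 1 \<le> y 1" using step[of 0] by (simp add: v_def)
    moreover have "(a 2 - a 1) / u \<le> y 2 - y 1"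
      using step[of 1] u by (simp add: v_def field_simps numeral_2_eq_2)
    \<comment> \<open>A unit of gain costs at least 1 at the first level but may cost only
      \<open>1 / u\<close> at the second. At least \<open>M\<close> is gained at the first, at an
      extra cost of at least \<open>M * (1 - 1 / u)\<close>.\<close>
    moreover have "M * (1 - 1 / u) \<le> a 1 * (1 - 1 / u)"
      using aM[of 0] u by (intro mult_right_mono) auto
    ultimately have "M * (1 - 1 / u) \<le> y 2 - a 2 / u"
      by (simp add: right_diff_distrib diff_divide_distrib)
    then show ?case by (simp add: diff_divide_distrib numeral_2_eq_2 field_simps)
  next
    case (Suc n)
    define x where "x = u * q ^ n"
    have x: "1 \<le> x" "1 \<le> q * x" using v1[of "Suc n"] v1[of "Suc (Suc n)"]
      by (simp_all add: x_def vS mult.left_commute)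
    have xS: "u * q ^ Suc n = q * x" by (simp add: x_def)
    have "(a (n + 3) - a (n + 2)) / (q * x) \<le> y (n + 3) - y (n + 2)"
      using step[of "n + 2"] x by (simp add: x_def vS numeral_eq_Suc pos_divide_le_eq mult_ac)
    \<comment> \<open>The ratio bound makes the numerator nonnegative, so the larger divisor can
      only shrink the quotient.\<close>
    moreover have "(a (n + 2) - opt_at x / \<rho>) / (q * x) \<le> (a (n + 2) - opt_at x / \<rho>) / x"
      using aopt[of "Suc n"] x q mult_right_mono[of 1 q x]
      by (intro divide_left_mono) (auto simp: vS x_def)
    moreover have "(L (q * x) - L x) / q / \<rho> \<le> (opt_at (q * x) - opt_at x) / (q * x) / \<rho>"
      using L[of x] x \<rho> by (intro divide_right_mono) auto
    ultimately have "(a (n + 3) - opt_at (q * x) / \<rho>) / (q * x) + (L (q * x) - L x) / q / \<rho>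
      \<le> y (n + 3) - y (n + 2) + (a (n + 2) - opt_at x / \<rho>) / x"
      by (simp add: diff_divide_distrib mult.commute)
    moreover have "n + 3 = Suc n + 2" by simp
    ultimately show ?case
      using Suc.IH unfolding xS x_def[symmetric]
      by (simp add: add_divide_distrib diff_divide_distrib numeral_eq_Suc)
  qed
  \<comment> \<open>The potential is at most the quantity spent, since the surplus subtracted in it
    is nonnegative.\<close>
  have "y (N + 2) \<le> B"
    using feasible_levels[of "N + 2" v] v1 unfolding y_def feasible_def by blast
  moreover have "0 \<le> (a (N + 2) - opt_at (u * q ^ N) / \<rho>) / (u * q ^ N)"
    using aopt[of "Suc N"] v1[of "Suc N"] by (simp add: vS)
  ultimately show ?thesis
    using main[of N] by (simp add: L_def right_diff_distrib sum_subtractf)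
qed

text \<open>With \<open>q\<close> the \<open>n\<close>-th root of \<open>\<theta> K / u\<close>,
  \<open>n\<close> steps lead exactly from \<open>u\<close> to \<open>\<theta> K\<close>; as
  \<open>n\<close> grows, \<open>q\<close> tends to 1.\<close>

lemma ratio_bound:
  assumes ratio: "competitive_ratio B K \<theta> m A \<le> ereal \<rho>"
    and u: "1 \<le> u" "u \<le> \<theta> K"
  shows "opt_at u / u + (\<Sum>j=1..K. weight j * (ln (\<theta> j) - ln (min u (\<theta> j))))
      \<le> \<rho> * (B - M * (1 - 1 / u))"
proof -
  define L where "L = (\<Sum>j=1..K. weight j * (ln (\<theta> j) - ln (min u (\<theta> j))))"
  have \<rho>: "0 < \<rho>" using opt_at_le_ALG(1)[OF ratio, of 0 "\<lambda>_. 1"] by simp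
  have "M * (1 - 1 / u) + (opt_at u / u + L / root n (\<theta> K / u)) / \<rho> \<le> B" if "0 < n" for n
  proof -
    have "u * root n (\<theta> K / u) ^ n = \<theta> K"
      using that u by (simp add: real_root_pow_pos2)
    moreover have "1 \<le> root n (\<theta> K / u)"
      using that u by simp
    moreover have "min (\<theta> K) (\<theta> j) = \<theta> j" if "j \<in> {1..K}" for j
      using mono_onD[OF theta_mono, of j K] that by auto
    ultimately show ?thesis
      using discrete_bound[OF ratio u(1), of "root n (\<theta> K / u)" n] by (simp add: L_def)
  qed
  then have "\<forall>\<^sub>F n in sequentially.
      M * (1 - 1 / u) + (opt_at u / u + L / root n (\<theta> K / u)) / \<rho> \<le> B"
    using eventually_gt_at_top[of "0::nat"] by (rule eventually_mono[rotated])
  moreover have "(\<lambda>n. M * (1 - 1 / u) + (opt_at u / u + L / root n (\<theta> K / u)) / \<rho>)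
      \<longlonglongrightarrow> M * (1 - 1 / u) + (opt_at u / u + L / 1) / \<rho>"
    using u \<rho> by (intro tendsto_intros LIMSEQ_root_const) auto
  ultimately have "M * (1 - 1 / u) + (opt_at u / u + L / 1) / \<rho> \<le> B"
    using tendsto_upperbound sequentially_bot by blast
  then have "(opt_at u / u + L) / \<rho> \<le> B - M * (1 - 1 / u)" by simp
  then show "opt_at u / u + L \<le> \<rho> * (B - M * (1 - 1 / u))"
    using \<rho> by (simp add: pos_divide_le_eq mult.commute)
qed

section \<open>The two lower bounds\<close>

text \<open>At \<open>u = 1\<close> the optimum bound is \<open>B\<close> and the term with
  \<open>M\<close> vanishes from \<open>ratio_bound\<close>; the rest is rewriting
  logarithms.\<close>

lemma ratio_ge_alpha_zero:
  assumes "competitive_ratio B K \<theta> m A \<le> ereal \<rho>"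
  shows "alpha_zero B K \<theta> m \<le> \<rho>"
proof -
  have K: "1 \<le> \<theta> K" using theta_ge_1 K_pos by simp
  have min1: "min 1 (\<theta> j) = 1" if "j \<in> {1..K}" for j using theta_ge_1 that by simp
  have "opt_at 1 = B" using sum_weight_eq by (simp add: opt_at_def min1 cong: sum.cong_simp)
  moreover have "(\<Sum>j=1..K. weight j * (ln (\<theta> j) - ln (min 1 (\<theta> j))))
      = (\<Sum>j=1..K. weight j * ln (\<theta> j))"
    by (intro sum.cong) (auto simp: min1)
  ultimately have le: "B + (\<Sum>j=1..K. weight j * ln (\<theta> j)) \<le> \<rho> * B"
    using ratio_bound[OF assms order_refl K] by simp
  have "(\<Sum>j=1..K. m j * ln (\<theta> j)) = (\<Sum>j=1..K. m j * ln (\<theta> K) - m j * ln (\<theta> K / \<theta> j))"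
  proof (rule sum.cong)
    fix j assume "j \<in> {1..K}"
    then have "1 \<le> \<theta> j" using theta_ge_1 by auto
    then show "m j * ln (\<theta> j) = m j * ln (\<theta> K) - m j * ln (\<theta> K / \<theta> j)"
      using K by (simp add: ln_div algebra_simps)
  qed simp
  also have "\<dots> = M * ln (\<theta> K) - (\<Sum>j=1..K. m j * ln (\<theta> K / \<theta> j))"
    by (simp add: sum_subtractf sum_distrib_right total_req_def)
  \<comment> \<open>The last term is 0 because \<open>ln 1 = 0\<close>.\<close>
  also have "(\<Sum>j=1..K. m j * ln (\<theta> K / \<theta> j)) = (\<Sum>j=1..<K. m j * ln (\<theta> K / \<theta> j))"
    using K K_pos by (simp add: sum.last_plus)
  finally have "B * alpha_zero B K \<theta> m = B + (\<Sum>j=1..K. weight j * ln (\<theta> j))"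
    unfolding sum_weight alpha_zero_def using B_pos
    by (simp add: algebra_simps sum_distrib_left)
  with le B_pos show ?thesis by (metis mult.commute mult_le_cancel_left_pos)
qed

text \<open>Take \<open>u\<close> with \<open>D + C * u = \<alpha> * M\<close>. The range of
  \<open>M\<close> places it between \<open>\<theta> (j - 1)\<close> and \<open>\<theta> j\<close>,
  so the classes below \<open>j\<close> are capped, the others have value \<open>u\<close>, and
  \<open>opt_at u = \<alpha> * M\<close>. Both sides of \<open>ratio_bound\<close> become multiples
  of \<open>B - M + M / u\<close>, which cancels.\<close>

lemma ratio_ge_alpha:
  assumes ratio: "competitive_ratio B K \<theta> m A \<le> ereal \<rho>"
    and theta0: "\<theta> 0 = 1" and j: "j \<in> {1..K}" and MB: "M < B"
    and M: "(\<theta> (j - 1) * coefC B m j + coefD \<theta> m j) / alpha B K \<theta> m j < M"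
      "M \<le> (\<theta> j * coefC B m j + coefD \<theta> m j) / alpha B K \<theta> m j"
  shows "alpha B K \<theta> m j \<le> \<rho>"
proof -
  define C D \<alpha> where "C = coefC B m j" "D = coefD \<theta> m j" "\<alpha> = alpha B K \<theta> m j"
  note defs = this
  have split: "(\<Sum>i=1..K. f i) = (\<Sum>i=1..<j. f i) + (\<Sum>i=j..K. f i)" for f :: "nat \<Rightarrow> real"
    using j sum.atLeastLessThan_concat[of 1 j "Suc K" f]
    by (simp add: atLeastLessThanSuc_atLeastAtMost)
  have CM: "C = B - M + (\<Sum>i=j..K. m i)"
    using split[of m] by (simp add: defs coefC_def total_req_def)
  have K: "1 \<le> \<theta> K" using theta_ge_1 K_pos by simp
  have "0 \<le> (\<Sum>i=j..K. m i)" using m_nonneg j by (intro sum_nonneg) auto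
  with CM MB have C: "0 < C" by simp
  have D: "0 \<le> D" unfolding defs coefD_def
    using m_nonneg theta_ge_1 j by (intro sum_nonneg mult_nonneg_nonneg) force+
  have M0: "0 \<le> M" using m_nonneg by (auto simp: total_req_def intro: sum_nonneg)
  have "j - 1 = 0 \<or> j - 1 \<in> {1..K}" using j by auto
  then have th: "1 \<le> \<theta> (j - 1)" "1 \<le> \<theta> j"
    using theta0 theta_ge_1 j by auto
  have num: "0 < \<theta> (j - 1) * C + D" "0 < \<theta> j * C + D"
    using th C D by (auto intro!: add_pos_nonneg)
  note M' = M[folded defs]
  \<comment> \<open>If \<open>\<alpha>\<close> is 0, division by it gives 0 at both ends and the
    interval for \<open>M\<close> is empty; if it is negative, the upper end is negative, against
    \<open>M \<ge> 0\<close>.\<close>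
  have \<alpha>: "0 < \<alpha>"
  proof (rule ccontr)
    assume "\<not> 0 < \<alpha>"
    then consider "\<alpha> = 0" | "\<alpha> < 0" by linarith
    then show False
    proof cases
      case 2
      then have "(\<theta> j * C + D) / \<alpha> < 0" using num by (simp add: divide_pos_neg)
      with M' M0 show False by simp
    qed (use M' M0 in auto)
  qed
  then have Mpos: "0 < M" using M'(1) num by (smt (verit) divide_pos_pos)
  define u where "u = (\<alpha> * M - D) / C"
  have uC: "D + C * u = \<alpha> * M" using C by (simp add: u_def)
  have ub: "\<theta> (j - 1) < u" "u \<le> \<theta> j"
    using M' \<alpha> C by (simp_all add: u_def field_simps)
  define S where "S = (\<Sum>i=j..<K. m i * ln (\<theta> K / \<theta> i))"
  have fp: "\<alpha> * (B - M) = C * ln (\<theta> K / u) - S"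
    using alpha_fixed_point[of K m B j \<theta>] Mpos MB C K by (simp add: defs u_def S_def)
  have u1: "1 \<le> u" using th ub by simp
  have mono: "\<theta> i \<le> \<theta> k" if "1 \<le> i" "i \<le> k" "k \<le> K" for i k
    using mono_onD[OF theta_mono, of i k] that by auto
  have uK: "u \<le> \<theta> K" using ub(2) mono[of j K] j by auto
  have low: "min u (\<theta> i) = \<theta> i" if "i \<in> {1..<j}" for i
  proof -
    have "i \<le> j - 1" "j - 1 \<le> K" using that j by auto
    then show ?thesis using mono[of i "j - 1"] that ub by auto
  qed
  have high: "min u (\<theta> i) = u" if "i \<in> {j..K}" for i
    using mono[of j i] that ub j by auto
  have "opt_at u = (B - M) * u + ((\<Sum>i=1..<j. m i * \<theta> i) + (\<Sum>i=j..K. m i * u))"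
    unfolding opt_at_def sum_weight split using uK by (simp add: low high)
  also have "\<dots> = D + C * u"
    by (simp add: CM defs(2) coefD_def algebra_simps sum_distrib_left[symmetric])
  finally have opt: "opt_at u = \<alpha> * M" using uC by simp
  have "(\<Sum>i=1..K. weight i * (ln (\<theta> i) - ln (min u (\<theta> i))))
      = (B - M) * (ln (\<theta> K) - ln u) + (\<Sum>i=j..K. m i * (ln (\<theta> i) - ln u))"
    unfolding sum_weight split using uK by (simp add: low high)
  also have "(\<Sum>i=j..K. m i * (ln (\<theta> i) - ln u))
      = (\<Sum>i=j..K. m i * ln (\<theta> K / u) - m i * ln (\<theta> K / \<theta> i))"
  proof (rule sum.cong)
    fix i assume "i \<in> {j..K}"
    then have "1 \<le> \<theta> i" using theta_ge_1 j by auto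
    then show "m i * (ln (\<theta> i) - ln u) = m i * ln (\<theta> K / u) - m i * ln (\<theta> K / \<theta> i)"
      using K u1 by (simp add: ln_div algebra_simps)
  qed simp
  also have "\<dots> = (\<Sum>i=j..K. m i) * ln (\<theta> K / u) - S"
    using K j by (simp add: sum_subtractf sum_distrib_right[symmetric] distrib_right S_def sum.last_plus)
  also have "(B - M) * (ln (\<theta> K) - ln u) + \<dots> = C * ln (\<theta> K / u) - S"
    using K u1 by (simp add: CM ln_div algebra_simps)
  finally have "\<alpha> * M / u + \<alpha> * (B - M) \<le> \<rho> * (B - M * (1 - 1 / u))"
    using ratio_bound[OF ratio u1 uK] opt fp by simp
  then have "\<alpha> * (B - M + M / u) \<le> \<rho> * (B - M + M / u)"
    by (simp add: algebra_simps)
  moreover have "0 < B - M + M / u" using MB Mpos u1 by (intro add_pos_pos) auto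
  ultimately show ?thesis by (simp add: defs)
qed

text \<open>If the ratio were smaller than \<open>x\<close>, some real number would lie strictly
  between them, so real bounds \<open>\<rho>\<close> suffice.\<close>

lemma not_less_competitive_ratio:
  assumes "\<And>\<rho>. competitive_ratio B K \<theta> m A \<le> ereal \<rho> \<Longrightarrow> x \<le> \<rho>"
  shows "\<not> competitive_ratio B K \<theta> m A < ereal x"
proof
  assume "competitive_ratio B K \<theta> m A < ereal x"
  then obtain \<rho> where "competitive_ratio B K \<theta> m A < ereal \<rho>" "ereal \<rho> < ereal x"
    using ereal_dense2 by blast
  with assms[of \<rho>] show False using less_imp_le by fastforce
qed

end

theorem theorem2:
  fixes B :: real and K :: nat and \<theta> m :: "nat \<Rightarrow> real" and A :: "agent list \<Rightarrow> real"
  assumes "B > 0" and "K \<ge> 1"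
    and "\<theta> 0 = 1" and "1 \<le> \<theta> 1" and "mono_on {1..K} \<theta>"
    and "\<forall>j\<in>{1..K}. m j \<ge> 0" and "total_req K m \<le> B"
    and "online_algorithm B K \<theta> A"
    and "\<forall>I. admissible K \<theta> m I \<longrightarrow> satisfies_GFQ K m I (run A I)"
  shows "(total_req K m \<le> B / alpha_zero B K \<theta> m \<longrightarrow>
            \<not> competitive_ratio B K \<theta> m A < ereal (alpha_zero B K \<theta> m)) \<and>
         (\<forall>j\<in>{1..K}. total_req K m < B \<longrightarrow>
            total_req K m \<in>
              {(\<theta> (j - 1) * coefC B m j + coefD \<theta> m j) / alpha B K \<theta> m j
               <.. (\<theta> j * coefC B m j + coefD \<theta> m j) / alpha B K \<theta> m j} \<longrightarrow>
            \<not> competitive_ratio B K \<theta> m A < ereal (alpha B K \<theta> m j))"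
proof -
  have "1 \<le> \<theta> j" if "j \<in> {1..K}" for j
    using mono_onD[OF assms(5), of 1 j] assms(4) that by auto
  then interpret gfq_algorithm B K \<theta> m A
    using assms by unfold_locales auto
  show ?thesis
    using ratio_ge_alpha_zero ratio_ge_alpha[OF _ assms(3)]
    by (intro conjI impI ballI not_less_competitive_ratio) auto
qed

end
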